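(* The problem of deciding, given a LIKE pattern $p$ and a string $t$, whether $t$ matches $p$ (with inputs encoded in binary) cannot be decided by a family of constant-depth, polynomial-size, unbounded fan-in boolean circuits; that is, it is not in AC$^0$.
   Context: Let $\Sigma$ be a finite alphabet containing the symbols $0$ and $1$. A LIKE pattern over $\Sigma$ is a finite string over $\Sigma \cup \{\%, \_\}$, where $\%,\_ \notin \Sigma$ are wildcards. A string $t\in\Sigma^*$ matches the pattern if $t$ (as a whole) belongs to the language obtained by reading each letter of $\Sigma$ as itself, each $\_$ as any single symbol of $\Sigma$, each $\%$ as any string in $\Sigma^*$ (possibly empty), and juxtaposition as concatenation. *)

theory Defs
  imports "HOL-Computational_Algebra.Polynomial"
begin

section \<open>LIKE patterns\<close>

datatype 'a like_sym = Lit 'a | Underscore | Percent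

type_synonym 'a like_pattern = "'a like_sym list"

text \<open>The alphabet is the whole type of letters; it is constrained to be finite in the theorem.\<close>

primrec sym_lang :: "'a like_sym \<Rightarrow> 'a list set" where
  "sym_lang (Lit a) = {[a]}"
| "sym_lang Underscore = {[a] |a. True}"
| "sym_lang Percent = UNIV"

primrec like_lang :: "'a like_pattern \<Rightarrow> 'a list set" where
  "like_lang [] = {[]}"
| "like_lang (s # p) = {u @ v |u v. u \<in> sym_lang s \<and> v \<in> like_lang p}"

definition like_matches :: "'a list \<Rightarrow> 'a like_pattern \<Rightarrow> bool" where
  "like_matches t p \<longleftrightarrow> t \<in> like_lang p"


section \<open>Binary encoding of the inputs\<close>

text \<open>An input \<open>(p, t)\<close> is first written as the string \<open>p # t\<close> with a separator \<open>#\<close> that is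
  neither a letter nor a wildcard, and then every token is replaced by a block of bits; all blocks
  have the same length. The block code itself is arbitrary.\<close>

datatype 'a token = Sym "'a like_sym" | Separator

definition block_code :: "('a token \<Rightarrow> bool list) \<Rightarrow> bool" where
  "block_code code \<longleftrightarrow> inj code \<and> (\<exists>b. \<forall>s. length (code s) = b)"

definition encode_input ::
    "('a token \<Rightarrow> bool list) \<Rightarrow> 'a like_pattern \<Rightarrow> 'a list \<Rightarrow> bool list" where
  "encode_input code p t =
     concat (map code (map Sym p @ [Separator] @ map (\<lambda>a. Sym (Lit a)) t))"

text \<open>As usual for decision problems, bit strings that encode no input are not in the language.\<close>

definition like_problem :: "('a token \<Rightarrow> bool list) \<Rightarrow> bool list set" where
  "like_problem code = {encode_input code p t |p t. like_matches t p}"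

lemma ex_block_code: "\<exists>code :: ('a :: finite) token \<Rightarrow> bool list. block_code code"
proof -
  have "s \<in> range Lit \<union> {Underscore, Percent}" for s :: "'a like_sym"
    by (cases s) auto
  then have "(UNIV :: 'a like_sym set) \<subseteq> range Lit \<union> {Underscore, Percent}" by blast
  then have fin: "finite (UNIV :: 'a like_sym set)"
    by (rule finite_subset) simp
  have "s \<in> range Sym \<union> {Separator}" for s :: "'a token"
    by (cases s) auto
  then have "(UNIV :: 'a token set) \<subseteq> range Sym \<union> {Separator}" by blast
  then have "finite (UNIV :: 'a token set)"
    by (rule finite_subset) (simp add: fin)
  then obtain ts :: "'a token list" where ts: "set ts = UNIV"
    using finite_list by blast
  define code :: "'a token \<Rightarrow> bool list" where "code s = map ((=) s) ts" for s
  have "inj code"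
  proof (rule injI)
    fix s s' assume "code s = code s'"
    then show "s = s'" using ts by (simp add: code_def map_eq_conv)
  qed
  then have "block_code code"
    by (simp add: block_code_def code_def)
  then show ?thesis by blast
qed

lemma encode_input_inject:
  assumes "block_code code" and "encode_input code p t = encode_input code p' t'"
  shows "p = p' \<and> t = t'"
proof -
  obtain b where inj: "inj code" and b: "\<And>s. length (code s) = b"
    using assms(1) by (auto simp: block_code_def)
  have "b \<noteq> 0"
    using inj_eq[OF inj, of Separator "Sym Percent"] b[of Separator] b[of "Sym Percent"] by auto
  have concat_inj: "us = vs"
    if "concat (map code us) = concat (map code vs)" for us vs
    using that
  proof (induction us arbitrary: vs)
    case Nil
    then have "concat (map code vs) = []" by simp
    then have "\<forall>s \<in> set vs. code s = []" by simp
    then have "set vs = {}" using b \<open>b \<noteq> 0\<close> by (metis all_not_in_conv list.size(3))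
    then show ?case by simp
  next
    case (Cons u us)
    show ?case
    proof (cases vs)
      case Nil
      then show ?thesis using Cons.prems b[of u] \<open>b \<noteq> 0\<close> by auto
    next
      case (Cons v vs')
      then show ?thesis
        using Cons.prems Cons.IH b inj_eq[OF inj] by simp
    qed
  qed
  have sep: "p = p' \<and> t = t'"
    if "map Sym p @ [Separator] @ map (\<lambda>a. Sym (Lit a)) t =
        map Sym p' @ [Separator] @ map (\<lambda>a. Sym (Lit a)) t'" for p p' and t t' :: "'a list"
    using that
  proof (induction p arbitrary: p')
    case Nil
    moreover have "inj (\<lambda>a :: 'a. Sym (Lit a))" by (simp add: inj_def)
    ultimately show ?case by (cases p') (auto dest: map_injective)
  next
    case (Cons s p)
    then show ?case by (cases p') auto
  qed
  show ?thesis
    using assms(2) concat_inj sep unfolding encode_input_def by blast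
qed


section \<open>Constant-depth circuits\<close>

text \<open>A circuit is a topologically sorted list of gates: a gate refers to its predecessors by
  their positions in the list, so gates may be shared. The last gate is the output. As fan-in is
  unbounded, \<open>AND\<close> and \<open>OR\<close> take an arbitrary set of predecessors; the empty set gives the
  constants.\<close>

datatype gate = INPUT nat | NOT nat | AND "nat set" | OR "nat set"

type_synonym circuit = "gate list"

primrec wf_gate :: "nat \<Rightarrow> nat \<Rightarrow> gate \<Rightarrow> bool" where
  "wf_gate n i (INPUT k) \<longleftrightarrow> k < n"
| "wf_gate n i (NOT j) \<longleftrightarrow> j < i"
| "wf_gate n i (AND J) \<longleftrightarrow> J \<subseteq> {..<i}"
| "wf_gate n i (OR J) \<longleftrightarrow> J \<subseteq> {..<i}"

definition wf_circuit :: "nat \<Rightarrow> circuit \<Rightarrow> bool" where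
  "wf_circuit n c \<longleftrightarrow> c \<noteq> [] \<and> (\<forall>i < length c. wf_gate n i (c ! i))"

primrec gate_value :: "bool list \<Rightarrow> bool list \<Rightarrow> gate \<Rightarrow> bool" where
  "gate_value x vs (INPUT k) \<longleftrightarrow> x ! k"
| "gate_value x vs (NOT j) \<longleftrightarrow> \<not> vs ! j"
| "gate_value x vs (AND J) \<longleftrightarrow> (\<forall>j\<in>J. vs ! j)"
| "gate_value x vs (OR J) \<longleftrightarrow> (\<exists>j\<in>J. vs ! j)"

definition circuit_values :: "circuit \<Rightarrow> bool list \<Rightarrow> bool list" where
  "circuit_values c x = foldl (\<lambda>vs g. vs @ [gate_value x vs g]) [] c"

definition circuit_output :: "circuit \<Rightarrow> bool list \<Rightarrow> bool" where
  "circuit_output c x = last (circuit_values c x)"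

definition circuit_size :: "circuit \<Rightarrow> nat" where
  "circuit_size c = length c"

primrec gate_depth :: "nat list \<Rightarrow> gate \<Rightarrow> nat" where
  "gate_depth ds (INPUT k) = 0"
| "gate_depth ds (NOT j) = Suc (ds ! j)"
| "gate_depth ds (AND J) = Suc (Max (insert 0 ((!) ds ` J)))"
| "gate_depth ds (OR J) = Suc (Max (insert 0 ((!) ds ` J)))"

definition circuit_depth :: "circuit \<Rightarrow> nat" where
  "circuit_depth c = last (foldl (\<lambda>ds g. ds @ [gate_depth ds g]) [] c)"

text \<open>Non-uniform: no computability is required of the family \<open>C\<close>, whose \<open>n\<close>-th member handles
  the inputs of length \<open>n\<close>.\<close>

definition AC0 :: "bool list set set" where
  "AC0 = {L. \<exists>(C :: nat \<Rightarrow> circuit) (q :: nat poly) (d :: nat).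
     (\<forall>n. wf_circuit n (C n) \<and> circuit_size (C n) \<le> poly q n \<and> circuit_depth (C n) \<le> d) \<and>
     (\<forall>x. circuit_output (C (length x)) x \<longleftrightarrow> x \<in> L)}"

end

theory Submission
  imports Defs "HOL-Real_Asymp.Real_Asymp"
begin

text \<open>The pattern \<open>%1%1\<dots>%1%\<close> with \<open>m + 1\<close> ones is matched by exactly the words with more than \<open>m\<close>
  ones, so circuits for the matching problem compute the majority of \<open>2m + 1\<close> bits. That this is
  impossible is Razborov's argument over the field with two elements. Replacing each gate by a
  disjunction of \<open>l\<close> suitably chosen parities of its inputs, a circuit of depth \<open>d\<close> agrees, outside a
  fraction \<open>size / 2\<^sup>l\<close> of the inputs, with a polynomial of degree \<open>l\<^sup>d\<close>. On the other hand, on a set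
  \<open>A\<close> where majority has degree \<open>D\<close>, every Boolean function has degree at most \<open>m + D\<close>: below and
  above the middle layer it can be interpolated in degree \<open>m\<close>, and majority selects between the two.
  Counting functions bounds \<open>|A|\<close> by the number of monomials of degree at most \<open>m + D\<close>, which
  forces \<open>D\<close> to be of order \<open>sqrt m\<close>.\<close>

section \<open>Low-degree functions over the two-element field\<close>

text \<open>An input is the set \<open>X \<subseteq> U\<close> of the variables that are true; addition is exclusive or, and the
  monomial of a set \<open>S\<close> of variables is \<open>S \<subseteq> X\<close>.\<close>

inductive low_degree :: "'b set \<Rightarrow> nat \<Rightarrow> ('b set \<Rightarrow> bool) \<Rightarrow> bool" for U k where
  zero: "low_degree U k (\<lambda>X. False)"
| add_monomial: "low_degree U k f \<Longrightarrow> S \<subseteq> U \<Longrightarrow> card S \<le> k \<Longrightarrow>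
    low_degree U k (\<lambda>X. f X \<noteq> (S \<subseteq> X))"

section \<open>Closure of low degree under Boolean operations\<close>

lemma low_degree_mono:
  assumes "low_degree U k f" and "k \<le> k'"
  shows "low_degree U k' f"
  using assms(1)
proof induction
  case (add_monomial f S)
  then show ?case using assms(2) by (intro low_degree.add_monomial) simp_all
qed (rule low_degree.zero)

lemma low_degree_monomial:
  assumes "S \<subseteq> U" and "card S \<le> k"
  shows "low_degree U k (\<lambda>X. S \<subseteq> X)"
  using low_degree.add_monomial[OF low_degree.zero assms] by simp

lemma low_degree_const: "low_degree U k (\<lambda>X. b)"
  using low_degree_monomial[of "{}" U k] low_degree.zero[of U k] by (cases b) auto

lemma low_degree_xor:
  assumes "low_degree U k f" and "low_degree U k g"
  shows "low_degree U k (\<lambda>X. f X \<noteq> g X)"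
  using assms
proof induction
  case zero
  then show ?case by simp
next
  case (add_monomial f S)
  then have "low_degree U k (\<lambda>X. (f X \<noteq> g X) \<noteq> (S \<subseteq> X))"
    by (intro low_degree.add_monomial) simp_all
  moreover have "(\<lambda>X. (f X \<noteq> g X) \<noteq> (S \<subseteq> X)) = (\<lambda>X. (f X \<noteq> (S \<subseteq> X)) \<noteq> g X)"
    by auto
  ultimately show ?case by simp
qed

lemma low_degree_not:
  assumes "low_degree U k f"
  shows "low_degree U k (\<lambda>X. \<not> f X)"
  using low_degree_xor[OF assms low_degree_const[of U k True]] by simp

text \<open>Variables are idempotent, so the product of the monomials of \<open>S\<close> and
  \<open>T\<close> is the monomial of \<open>S \<union> T\<close>.\<close>

lemma low_degree_monomial_conj:
  assumes "low_degree U k f" and "S \<subseteq> U" and "card S \<le> j"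
  shows "low_degree U (j + k) (\<lambda>X. S \<subseteq> X \<and> f X)"
  using assms(1)
proof induction
  case zero
  then show ?case by (simp add: low_degree.zero)
next
  case (add_monomial f T)
  have "card (S \<union> T) \<le> j + k"
    using card_Un_le[of S T] assms(3) add_monomial.hyps by linarith
  then have "low_degree U (j + k) (\<lambda>X. (S \<subseteq> X \<and> f X) \<noteq> (S \<union> T \<subseteq> X))"
    using add_monomial assms(2) by (intro low_degree.add_monomial) auto
  moreover have "(\<lambda>X. (S \<subseteq> X \<and> f X) \<noteq> (S \<union> T \<subseteq> X)) = (\<lambda>X. S \<subseteq> X \<and> (f X \<noteq> (T \<subseteq> X)))"
    by auto
  ultimately show ?case by simp
qed

text \<open>Conjunction is multiplication over the two-element field: it distributes over exclusive
  or, and degrees add.\<close>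

lemma low_degree_conj:
  assumes "low_degree U j f" and "low_degree U k g"
  shows "low_degree U (j + k) (\<lambda>X. f X \<and> g X)"
  using assms(1)
proof induction
  case zero
  then show ?case by (simp add: low_degree.zero)
next
  case (add_monomial f S)
  have "low_degree U (j + k) (\<lambda>X. (f X \<and> g X) \<noteq> (S \<subseteq> X \<and> g X))"
    using add_monomial low_degree_monomial_conj[OF assms(2)] by (intro low_degree_xor) auto
  moreover have "(\<lambda>X. (f X \<and> g X) \<noteq> (S \<subseteq> X \<and> g X)) = (\<lambda>X. (f X \<noteq> (S \<subseteq> X)) \<and> g X)"
    by auto
  ultimately show ?case by simp
qed

lemma low_degree_disj:
  assumes "low_degree U j f" and "low_degree U k g"
  shows "low_degree U (j + k) (\<lambda>X. f X \<or> g X)"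
proof -
  have "low_degree U (j + k) (\<lambda>X. \<not> (\<not> f X \<and> \<not> g X))"
    by (intro low_degree_not low_degree_conj assms)
  then show ?thesis by simp
qed

lemma odd_card_insert_filter:
  assumes "finite A" and "a \<notin> A"
  shows "odd (card {x \<in> insert a A. P x}) \<longleftrightarrow> (odd (card {x \<in> A. P x}) \<noteq> P a)"
proof (cases "P a")
  case True
  then have "{x \<in> insert a A. P x} = insert a {x \<in> A. P x}" by auto
  then show ?thesis using assms True by simp
next
  case False
  then have "{x \<in> insert a A. P x} = {x \<in> A. P x}" by auto
  then show ?thesis using False by simp
qed

lemma low_degree_odd_card:
  assumes "finite A" and "\<And>a. a \<in> A \<Longrightarrow> low_degree U k (P a)"
  shows "low_degree U k (\<lambda>X. odd (card {a \<in> A. P a X}))"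
  using assms
proof (induction A rule: finite_induct)
  case empty
  then show ?case by (simp add: low_degree.zero)
next
  case (insert a A)
  then have "low_degree U k (\<lambda>X. odd (card {a \<in> A. P a X}) \<noteq> P a X)"
    by (intro low_degree_xor) auto
  moreover have "(\<lambda>X. odd (card {x \<in> insert a A. P x X})) =
      (\<lambda>X. odd (card {a \<in> A. P a X}) \<noteq> P a X)"
    by (intro ext odd_card_insert_filter insert.hyps)
  ultimately show ?case by simp
qed

section \<open>Monomial expansions and counting\<close>

text \<open>A derivation may add the same monomial repeatedly. Equal monomials cancel in pairs, so a
  set of monomials suffices, and such sets can be counted.\<close>

lemma low_degree_monomials:
  assumes "low_degree U k f" and "finite U"
  shows "\<exists>F \<subseteq> {S. S \<subseteq> U \<and> card S \<le> k}. f = (\<lambda>X. odd (card {S \<in> F. S \<subseteq> X}))"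
  using assms(1)
proof induction
  case zero
  then show ?case by (intro exI[of _ "{}"]) simp
next
  case (add_monomial f S)
  then obtain F where F: "F \<subseteq> {S. S \<subseteq> U \<and> card S \<le> k}"
    and f: "f = (\<lambda>X. odd (card {S \<in> F. S \<subseteq> X}))" by blast
  have "F \<subseteq> Pow U" using F by auto
  then have fin: "finite F" using assms(2) finite_subset by blast
  show ?case
  proof (cases "S \<in> F")
    case False
    then show ?thesis using F f add_monomial.hyps fin odd_card_insert_filter[of F S]
      by (intro exI[of _ "insert S F"]) auto
  next
    case True
    \<comment> \<open>Adding \<open>S\<close> a second time cancels it, so the witness drops
      \<open>S\<close>.\<close>
    have "odd (card {T \<in> F. T \<subseteq> X}) \<longleftrightarrow> (odd (card {T \<in> F - {S}. T \<subseteq> X}) \<noteq> (S \<subseteq> X))" for X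
      using odd_card_insert_filter[of "F - {S}" S "\<lambda>T. T \<subseteq> X"] fin True
      by (simp add: insert_absorb)
    then have "(\<lambda>X. f X \<noteq> (S \<subseteq> X)) = (\<lambda>X. odd (card {T \<in> F - {S}. T \<subseteq> X}))"
      using f by (intro ext) auto
    then show ?thesis using F by (intro exI[of _ "F - {S}"]) auto
  qed
qed

text \<open>Every subset of \<open>A\<close> is cut out on \<open>A\<close> by some set of
  monomials, so \<open>A\<close> has at most as many subsets as there are sets of monomials.
  Comparing powers of two replaces a dimension count.\<close>

lemma card_le_if_all_low_degree:
  fixes U :: "'b set"
  assumes "finite U" and "A \<subseteq> Pow U"
    and all: "\<And>f. \<exists>g. low_degree U k g \<and> (\<forall>X \<in> A. g X = f X)"
  shows "card A \<le> card {S. S \<subseteq> U \<and> card S \<le> k}"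
proof -
  let ?M = "{S. S \<subseteq> U \<and> card S \<le> k}"
  have finM: "finite ?M" using assms(1) by auto
  have finA: "finite A" using assms(1,2) finite_subset by blast
  have "Pow A \<subseteq> (\<lambda>F. {X \<in> A. odd (card {S \<in> F. S \<subseteq> X})}) ` Pow ?M"
  proof
    fix Y assume "Y \<in> Pow A"
    obtain g where g: "low_degree U k g" "\<forall>X \<in> A. g X = (X \<in> Y)" using all[of "\<lambda>X. X \<in> Y"] by auto
    from low_degree_monomials[OF g(1) assms(1)] obtain F
      where F: "F \<subseteq> ?M" "g = (\<lambda>X. odd (card {S \<in> F. S \<subseteq> X}))" by blast
    have "Y = {X \<in> A. g X}" using g(2) \<open>Y \<in> Pow A\<close> by auto
    then show "Y \<in> (\<lambda>F. {X \<in> A. odd (card {S \<in> F. S \<subseteq> X})}) ` Pow ?M" using F by blast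
  qed
  then have "card (Pow A) \<le> card (Pow ?M)"
    using finM by (meson card_image_le card_mono finite_Pow_iff finite_imageI le_trans)
  then show ?thesis using finA finM by (simp add: card_Pow)
qed

section \<open>Interpolation on the lower layers of the cube, and complementation\<close>

text \<open>The monomial of a set of size \<open>Suc k\<close> is false on every other set of at
  most that size, so wrong values on a new layer can be repaired without disturbing the earlier
  layers.\<close>

lemma interpolation:
  assumes "finite U"
  shows "\<exists>g. low_degree U k g \<and> (\<forall>X. X \<subseteq> U \<and> card X \<le> k \<longrightarrow> g X = f X)"
proof (induction k)
  case 0
  have "low_degree U 0 (\<lambda>X. f {})" by (rule low_degree_const)
  moreover have "X = {}" if "X \<subseteq> U \<and> card X \<le> 0" for X
    using that finite_subset[OF _ assms, of X] by auto
  ultimately show ?case by blast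
next
  case (Suc k)
  then obtain g where g: "low_degree U k g" "\<And>X. X \<subseteq> U \<Longrightarrow> card X \<le> k \<Longrightarrow> g X = f X" by blast
  define F where "F = {S. S \<subseteq> U \<and> card S = Suc k \<and> g S \<noteq> f S}"
  define h where "h X \<longleftrightarrow> (g X \<noteq> odd (card {S \<in> F. S \<subseteq> X}))" for X
  have "F \<subseteq> Pow U" by (auto simp: F_def)
  then have finF: "finite F" using assms finite_subset by blast
  have "low_degree U (Suc k) h"
    unfolding h_def using g(1) finF
    by (intro low_degree_xor low_degree_odd_card low_degree_monomial)
      (auto simp: F_def intro: low_degree_mono)
  moreover have "h X = f X" if X: "X \<subseteq> U" "card X \<le> Suc k" for X
  proof -
    have finX: "finite X" using X assms finite_subset by blast
    have sub: "S = X" if "S \<in> F" "S \<subseteq> X" for S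
    proof -
      have "card X \<le> card S" using that(1) X by (auto simp: F_def)
      then show ?thesis using card_seteq[OF finX that(2)] by simp
    qed
    show ?thesis
    proof (cases "X \<in> F")
      case True
      then have "{S \<in> F. S \<subseteq> X} = {X}" using sub by auto
      then show ?thesis using True by (auto simp: h_def F_def)
    next
      case False
      then have none: "{S \<in> F. S \<subseteq> X} = {}" using sub by auto
      have "g X = f X" using False X g(2)[of X] by (cases "card X = Suc k") (auto simp: F_def)
      then show ?thesis unfolding h_def none by simp
    qed
  qed
  ultimately show ?case by blast
qed

lemma low_degree_disjoint:
  assumes "finite S" and "S \<subseteq> U"
  shows "low_degree U (card S) (\<lambda>X. S \<inter> X = {})"
  using assms
proof (induction S rule: finite_induct)
  case empty
  then show ?case by (simp add: low_degree_const)
next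
  case (insert a S)
  then have "low_degree U (1 + card S) (\<lambda>X. \<not> {a} \<subseteq> X \<and> S \<inter> X = {})"
    by (intro low_degree_conj low_degree_not low_degree_monomial) auto
  moreover have "(\<lambda>X. \<not> {a} \<subseteq> X \<and> S \<inter> X = {}) = (\<lambda>X. insert a S \<inter> X = {})" by auto
  ultimately show ?case using insert.hyps by simp
qed

text \<open>Complementing the input turns the monomial of \<open>S\<close> into the product of the
  negated variables of \<open>S\<close>, whose degree is still at most
  \<open>card S\<close>.\<close>

lemma low_degree_complement:
  assumes "low_degree U k f" and "finite U"
  shows "\<exists>g. low_degree U k g \<and> (\<forall>X. g X = f (U - X))"
  using assms(1)
proof induction
  case zero
  then show ?case using low_degree.zero by auto
next
  case (add_monomial f S)
  then obtain g where g: "low_degree U k g" "\<forall>X. g X = f (U - X)" by blast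
  have "finite S" using add_monomial.hyps assms(2) finite_subset by blast
  then have "low_degree U k (\<lambda>X. g X \<noteq> (S \<inter> X = {}))"
    using g(1) add_monomial.hyps
    by (intro low_degree_xor) (auto intro: low_degree_mono[OF low_degree_disjoint])
  moreover have "S \<inter> X = {} \<longleftrightarrow> S \<subseteq> U - X" for X using add_monomial.hyps by auto
  ultimately show ?case using g(2) by blast
qed

section \<open>The degree of majority\<close>

lemma majority_agreement:
  assumes fin: "finite U" and cU: "card U = 2 * m + 1"
    and P: "low_degree U D P" and A: "A \<subseteq> Pow U"
    and agree: "\<And>X. X \<in> A \<Longrightarrow> P X \<longleftrightarrow> m < card X"
  shows "card A \<le> card {S. S \<subseteq> U \<and> card S \<le> m + D}"
proof (rule card_le_if_all_low_degree[OF fin A])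
  fix f
  obtain g where g: "low_degree U m g" "\<forall>X. X \<subseteq> U \<and> card X \<le> m \<longrightarrow> g X = f X"
    using interpolation[OF fin, of m f] by (elim exE conjE) (rule that)
  \<comment> \<open>Sets above the middle are reached through their complements, which have at most
    \<open>m\<close> elements because \<open>card U\<close> is \<open>2 * m + 1\<close>.\<close>
  obtain h' where h': "low_degree U m h'" "\<forall>X. X \<subseteq> U \<and> card X \<le> m \<longrightarrow> h' X = f (U - X)"
    using interpolation[OF fin, of m "\<lambda>X. f (U - X)"] by (elim exE conjE) (rule that)
  obtain h where h: "low_degree U m h" "\<forall>X. h X = h' (U - X)"
    using low_degree_complement[OF h'(1) fin] by (elim exE conjE) (rule that)
  have hf: "h X = f X" if "X \<subseteq> U" "m < card X" for X
  proof -
    have "card (U - X) \<le> m"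
      using that fin cU by (simp add: card_Diff_subset finite_subset)
    then show ?thesis using h(2) h'(2) that(1) by (simp add: double_diff)
  qed
  \<comment> \<open>\<open>P\<close> selects between the upper and the lower interpolant. The two
    conjunctions exclude each other, so exclusive or acts as disjunction.\<close>
  have "low_degree U (m + D) (\<lambda>X. (h X \<and> P X) \<noteq> (g X \<and> \<not> P X))"
    by (intro low_degree_xor low_degree_conj low_degree_not g(1) h(1) P)
  moreover have "((h X \<and> P X) \<noteq> (g X \<and> \<not> P X)) = f X" if "X \<in> A" for X
  proof -
    have "X \<subseteq> U" using that A by blast
    moreover have "\<not> m < card X \<Longrightarrow> g X = f X" using g(2) \<open>X \<subseteq> U\<close> by simp
    ultimately show ?thesis using agree[OF that] hf[of X] by (cases "m < card X") simp_all
  qed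
  ultimately show "\<exists>g. low_degree U (m + D) g \<and> (\<forall>X \<in> A. g X = f X)"
    by (intro exI[of _ "\<lambda>X. (h X \<and> P X) \<noteq> (g X \<and> \<not> P X)"] conjI ballI)
qed

section \<open>Estimates of binomial coefficients and their sums\<close>

text \<open>This is the bound \<open>4 ^ m / sqrt (2 * m + 1)\<close> on the central binomial
  coefficient, squared to stay within the natural numbers.\<close>

lemma central_binomial_upper: "(2 * m choose m)\<^sup>2 * (2 * m + 1) \<le> 16 ^ m"
proof (induction m)
  case 0
  then show ?case by simp
next
  case (Suc m)
  let ?a = "2 * m choose m" and ?b = "2 * Suc m choose Suc m"
  \<comment> \<open>The ratio of consecutive central binomial coefficients, free of
    division.\<close>
  have s: "Suc m * ?b = 2 * (2 * m + 1) * ?a"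
  proof -
    have "Suc m * (Suc (2 * m) choose m) = (2 * m + 1) * ?a"
      using Suc_times_binomial[of m "2 * m"] Suc_times_binomial_add[of m m]
      by (simp add: mult_2)
    moreover have "?b = 2 * (Suc (2 * m) choose m)"
      using binomial_symmetric[of "Suc m" "Suc (2 * m)"] by simp
    ultimately show ?thesis by (simp only: mult.left_commute mult.assoc)
  qed
  have "(Suc m)\<^sup>2 * (?b\<^sup>2 * (2 * Suc m + 1)) = (Suc m * ?b)\<^sup>2 * (2 * m + 3)"
  proof -
    have "2 * Suc m + 1 = 2 * m + 3" by simp
    then show ?thesis by (simp only: power_mult_distrib mult.assoc)
  qed
  also have "\<dots> = (?a\<^sup>2 * (2 * m + 1)) * (4 * ((2 * m + 1) * (2 * m + 3)))"
    unfolding s by (simp add: power2_eq_square algebra_simps)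
  also have "\<dots> \<le> 16 ^ m * (4 * ((2 * m + 1) * (2 * m + 3)))"
    using Suc.IH by (rule mult_le_mono1)
  \<comment> \<open>\<open>(2 * m + 1) * (2 * m + 3)\<close> is one less than the square of
    \<open>2 * m + 2\<close>.\<close>
  also have "\<dots> \<le> 16 ^ m * (16 * (Suc m)\<^sup>2)"
    by (intro mult_le_mono2) (simp add: power2_eq_square algebra_simps)
  also have "\<dots> = (Suc m)\<^sup>2 * 16 ^ Suc m" by simp
  finally show ?case by (subst (asm) mult_le_cancel1) simp
qed

lemma card_subsets_card_le:
  assumes "finite U"
  shows "card {S. S \<subseteq> U \<and> card S \<le> k} = (\<Sum>i\<le>k. card U choose i)"
proof -
  have "{S. S \<subseteq> U \<and> card S \<le> k} = (\<Union>i\<in>{..k}. {S. S \<subseteq> U \<and> card S = i})" by auto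
  then have "card {S. S \<subseteq> U \<and> card S \<le> k} = (\<Sum>i\<le>k. card {S. S \<subseteq> U \<and> card S = i})"
    using assms by (simp only:) (subst card_UN_disjoint, auto)
  then show ?thesis using assms by (simp add: n_subsets)
qed

text \<open>By symmetry the lower half of the row sums to \<open>4 ^ m\<close>. Each of the
  \<open>D\<close> further entries is, by Pascal's rule, a sum of two entries bounded by the central
  one.\<close>

lemma sum_binomial_above_half:
  "(\<Sum>i\<le>m + D. 2 * m + 1 choose i) \<le> 4 ^ m + D * (2 * (2 * m choose m))"
proof (induction D)
  case 0
  have "(\<Sum>i\<le>m. 2 * m + 1 choose i) = 4 ^ m"
    using binomial_r_part_sum[of m] by (simp add: power_mult)
  then show ?case by simp
next
  case (Suc D)
  have le: "2 * m choose i \<le> 2 * m choose m" for i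
    using binomial_maximum'[of m i] by simp
  have "2 * m + 1 choose (m + Suc D) \<le> 2 * (2 * m choose m)"
    using le[of "m + D"] le[of "m + Suc D"] by simp
  then show ?case using Suc by simp
qed

section \<open>Approximating circuits by low-degree functions\<close>

text \<open>For each \<open>X\<close>, toggling one true input of the disjunction in \<open>S\<close> shows that exactly half of all
  \<open>S\<close> detect it; hence some \<open>S\<close> is at least as good as the average.\<close>

lemma exists_good_parity:
  assumes "finite B" and "finite J" and "\<And>X. X \<in> B \<Longrightarrow> \<exists>j \<in> J. P j X"
  shows "\<exists>S \<subseteq> J. 2 * card {X \<in> B. even (card {j \<in> S. P j X})} \<le> card B"
proof (rule ccontr)
  assume none: "\<not> ?thesis"
  have large: "card B < 2 * card {X \<in> B. even (card {j \<in> S. P j X})}" if "S \<in> Pow J" for S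
  proof (rule ccontr)
    assume "\<not> ?thesis"
    then have "\<exists>S \<subseteq> J. 2 * card {X \<in> B. even (card {j \<in> S. P j X})} \<le> card B"
      using that by (intro exI[of _ S]) simp
    with none show False by contradiction
  qed
  have half: "2 * card {S \<in> Pow J. even (card {j \<in> S. P j X})} = card (Pow J)" if X: "X \<in> B" for X
  proof -
    obtain a where a: "a \<in> J" "P a X" using assms(3)[OF X] by blast
    let ?E = "{S \<in> Pow J. even (card {j \<in> S. P j X})}"
    let ?O = "{S \<in> Pow J. odd (card {j \<in> S. P j X})}"
    define t where "t S = (if a \<in> S then S - {a} else insert a S)" for S
    have toggle: "even (card {j \<in> t S. P j X}) \<longleftrightarrow> odd (card {j \<in> S. P j X})" if "S \<in> Pow J" for S
    proof -
      have "finite S" using that assms(2) finite_subset by blast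
      then have *: "odd (card {j \<in> insert a (S - {a}). P j X}) \<longleftrightarrow> even (card {j \<in> S - {a}. P j X})"
        using odd_card_insert_filter[of "S - {a}" a "\<lambda>j. P j X"] a(2) by simp
      show ?thesis
      proof (cases "a \<in> S")
        case True
        then have "insert a (S - {a}) = S" by auto
        then have "odd (card {j \<in> S. P j X}) \<longleftrightarrow> even (card {j \<in> S - {a}. P j X})"
          using * by (simp only:)
        then show ?thesis using True unfolding t_def by (simp only: if_True)
      next
        case False
        then have "S - {a} = S" by auto
        then show ?thesis using * False unfolding t_def by (simp only: if_False) blast
      qed
    qed
    have "t (t S) = S" for S by (auto simp: t_def)
    moreover have "t S \<subseteq> J" if "S \<subseteq> J" for S using that a(1) by (auto simp: t_def)
    ultimately have "bij_betw t ?E ?O"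
      by (intro bij_betw_byWitness[where f' = t]) (use toggle in auto)
    then have "card ?E = card ?O" by (rule bij_betw_same_card)
    moreover have "card (Pow J) = card ?E + card ?O"
    proof -
      have "Pow J = ?E \<union> ?O" by auto
      also have "card \<dots> = card ?E + card ?O" using assms(2) by (intro card_Un_disjoint) auto
      finally show ?thesis .
    qed
    ultimately show ?thesis by simp
  qed
  \<comment> \<open>If every \<open>S\<close> missed more than half of \<open>B\<close>, the
    inequality summed over all \<open>S\<close> would be strict. Counting the same pairs by
    \<open>X\<close>, with \<open>half\<close>, gives equality.\<close>
  have "(\<Sum>S\<in>Pow J. card B) < (\<Sum>S\<in>Pow J. 2 * card {X \<in> B. even (card {j \<in> S. P j X})})"
    by (rule sum_strict_mono) (use large assms(2) in auto)
  also have "\<dots> = 2 * (\<Sum>S\<in>Pow J. card {X \<in> B. even (card {j \<in> S. P j X})})"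
    by (simp add: sum_distrib_left)
  also have "\<dots> = 2 * (\<Sum>X\<in>B. card {S \<in> Pow J. even (card {j \<in> S. P j X})})"
    by (intro arg_cong[where f = "(*) 2"] sum_multicount_gen ballI refl assms(1))
      (simp add: assms(2))
  also have "\<dots> = (\<Sum>X\<in>B. card (Pow J))"
    unfolding sum_distrib_left by (intro sum.cong refl half)
  finally show False by (simp add: mult.commute)
qed

text \<open>One more parity, chosen for the inputs still missed, at least halves their number. No
  correct input becomes wrong: where the disjunction is false, every parity is false.\<close>

lemma disjunction_approximation_one_sided:
  assumes "finite U" and "finite J" and P: "\<forall>j \<in> J. low_degree U k (P j)"
  shows "\<exists>Q. low_degree U (l * k) Q \<and> (\<forall>X. Q X \<longrightarrow> (\<exists>j \<in> J. P j X)) \<and>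
    card {X \<in> Pow U. \<not> Q X \<and> (\<exists>j \<in> J. P j X)} * 2 ^ l \<le> 2 ^ card U"
proof (induction l)
  case 0
  have "card {X \<in> Pow U. \<exists>j \<in> J. P j X} \<le> card (Pow U)"
    using assms(1) by (intro card_mono) auto
  then show ?case using assms(1)
    by (intro exI[of _ "\<lambda>X. False"]) (simp add: low_degree.zero card_Pow)
next
  case (Suc l)
  then obtain Q where Q: "low_degree U (l * k) Q" "\<forall>X. Q X \<longrightarrow> (\<exists>j \<in> J. P j X)"
    and card: "card {X \<in> Pow U. \<not> Q X \<and> (\<exists>j \<in> J. P j X)} * 2 ^ l \<le> 2 ^ card U"
    by (elim exE conjE) (rule that)
  define B where "B = {X \<in> Pow U. \<not> Q X \<and> (\<exists>j \<in> J. P j X)}"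
  have "finite B" using assms(1) by (simp add: B_def)
  moreover have "\<And>X. X \<in> B \<Longrightarrow> \<exists>j \<in> J. P j X" by (simp add: B_def)
  ultimately have "\<exists>S \<subseteq> J. 2 * card {X \<in> B. even (card {j \<in> S. P j X})} \<le> card B"
    by (rule exists_good_parity[OF _ assms(2)])
  then obtain S where S: "S \<subseteq> J" "2 * card {X \<in> B. even (card {j \<in> S. P j X})} \<le> card B"
    by (elim exE conjE) (rule that)
  define R where "R X \<longleftrightarrow> odd (card {j \<in> S. P j X}) \<or> Q X" for X
  have "finite S" using S(1) assms(2) finite_subset by blast
  moreover have "low_degree U k (P j)" if "j \<in> S" for j using P S(1) that by blast
  ultimately have "low_degree U k (\<lambda>X. odd (card {j \<in> S. P j X}))"
    by (rule low_degree_odd_card)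
  from low_degree_disj[OF this Q(1)] have deg: "low_degree U (Suc l * k) R"
    by (simp add: R_def[abs_def])
  have sound: "\<exists>j \<in> J. P j X" if "R X" for X
  proof (cases "Q X")
    case True
    then show ?thesis using Q(2) by simp
  next
    case False
    then have "card {j \<in> S. P j X} \<noteq> 0" using that unfolding R_def by (intro notI) simp
    then obtain j where "j \<in> S" "P j X" by (auto simp: card_eq_0_iff)
    then show ?thesis using S(1) by blast
  qed
  have "{X \<in> Pow U. \<not> R X \<and> (\<exists>j \<in> J. P j X)} = {X \<in> B. even (card {j \<in> S. P j X})}"
    unfolding R_def B_def by blast
  moreover have "card {X \<in> B. even (card {j \<in> S. P j X})} * 2 ^ Suc l \<le> 2 ^ card U"
    using mult_le_mono1[OF S(2), of "2 ^ l"] card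
    by (simp only: B_def[symmetric] power_Suc mult.assoc mult.left_commute)
  ultimately have "card {X \<in> Pow U. \<not> R X \<and> (\<exists>j \<in> J. P j X)} * 2 ^ Suc l \<le> 2 ^ card U"
    by (simp only:)
  with deg sound show ?case by (intro exI[of _ R] conjI allI impI)
qed

text \<open>Gathering the errors in a set \<open>B\<close> hides on which side they lie, so that the
  same form serves conjunctions by De Morgan.\<close>

lemma disjunction_approximation:
  assumes "finite U" and "finite J" and "\<forall>j \<in> J. low_degree U k (P j)"
  shows "\<exists>Q B. low_degree U (l * k) Q \<and> B \<subseteq> Pow U \<and> card B * 2 ^ l \<le> 2 ^ card U \<and>
    (\<forall>X \<in> Pow U - B. Q X \<longleftrightarrow> (\<exists>j \<in> J. P j X))"
proof -
  obtain Q where Q: "low_degree U (l * k) Q" "\<forall>X. Q X \<longrightarrow> (\<exists>j \<in> J. P j X)"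
    "card {X \<in> Pow U. \<not> Q X \<and> (\<exists>j \<in> J. P j X)} * 2 ^ l \<le> 2 ^ card U"
    using disjunction_approximation_one_sided[OF assms, where l = l] by (elim exE conjE) (rule that)
  then show ?thesis
    by (intro exI[of _ Q] exI[of _ "{X \<in> Pow U. \<not> Q X \<and> (\<exists>j \<in> J. P j X)}"]) auto
qed

lemma conjunction_approximation:
  assumes "finite U" and "finite J" and "\<forall>j \<in> J. low_degree U k (P j)"
  shows "\<exists>Q B. low_degree U (l * k) Q \<and> B \<subseteq> Pow U \<and> card B * 2 ^ l \<le> 2 ^ card U \<and>
    (\<forall>X \<in> Pow U - B. Q X \<longleftrightarrow> (\<forall>j \<in> J. P j X))"
proof -
  have "\<forall>j \<in> J. low_degree U k (\<lambda>X. \<not> P j X)" using assms(3) low_degree_not by blast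
  from disjunction_approximation[OF assms(1,2) this, where l = l]
  obtain Q B where QB: "low_degree U (l * k) Q" "B \<subseteq> Pow U" "card B * 2 ^ l \<le> 2 ^ card U"
    "\<forall>X \<in> Pow U - B. Q X \<longleftrightarrow> (\<exists>j \<in> J. \<not> P j X)"
    by (elim exE conjE) (rule that)
  then show ?thesis
    by (intro exI[of _ "\<lambda>X. \<not> Q X"] exI[of _ B]) (auto intro: low_degree_not)
qed

text \<open>\<open>circuit_depth\<close> is only the last entry of this list, but the degree has to
  be tracked at every gate.\<close>

definition gate_depths :: "circuit \<Rightarrow> nat list" where
  "gate_depths c = foldl (\<lambda>ds g. ds @ [gate_depth ds g]) [] c"

lemma circuit_values_simps [simp]:
  "circuit_values [] x = []"
  "circuit_values (c @ [g]) x = circuit_values c x @ [gate_value x (circuit_values c x) g]"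
  by (simp_all add: circuit_values_def)

lemma gate_depths_simps [simp]:
  "gate_depths [] = []"
  "gate_depths (c @ [g]) = gate_depths c @ [gate_depth (gate_depths c) g]"
  by (simp_all add: gate_depths_def)

lemma length_circuit_values [simp]: "length (circuit_values c x) = length c"
  by (induction c rule: rev_induct) auto

lemma length_gate_depths [simp]: "length (gate_depths c) = length c"
  by (induction c rule: rev_induct) auto

text \<open>Each level multiplies the degree by at most \<open>l\<close>. The set \<open>B\<close>
  is chosen relative to the approximations \<open>P\<close>; quantifying over all \<open>vs\<close>
  that agree with them keeps the errors of earlier gates separate.\<close>

lemma gate_approximation:
  assumes fin: "finite U" and l: "1 \<le> l"
    and inputs: "\<forall>k < N. low_degree U 1 (\<lambda>X. x X ! k)"
    and wf: "wf_gate N i g"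
    and P: "\<forall>j < i. low_degree U (l ^ (ds ! j)) (P j)"
  shows "\<exists>Q B. low_degree U (l ^ gate_depth ds g) Q \<and> B \<subseteq> Pow U \<and> card B * 2 ^ l \<le> 2 ^ card U \<and>
    (\<forall>X \<in> Pow U - B. \<forall>vs. (\<forall>j < i. vs ! j = P j X) \<longrightarrow> Q X = gate_value (x X) vs g)"
proof -
  have degree: "\<forall>j \<in> J. low_degree U (l ^ Max (insert 0 ((!) ds ` J))) (P j)"
    if "J \<subseteq> {..<i}" for J
  proof
    fix j assume "j \<in> J"
    have "finite J" using that finite_subset by blast
    then have "ds ! j \<le> Max (insert 0 ((!) ds ` J))" using \<open>j \<in> J\<close> by (intro Max_ge) auto
    then show "low_degree U (l ^ Max (insert 0 ((!) ds ` J))) (P j)"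
      using that l \<open>j \<in> J\<close> by (intro low_degree_mono[OF P[rule_format]] power_increasing) auto
  qed
  have index: "finite J" "\<And>j. j \<in> J \<Longrightarrow> j < i" if "J \<subseteq> {..<i}" for J
    using that finite_subset by auto
  show ?thesis
  proof (cases g)
    case (INPUT k)
    then show ?thesis using inputs wf
      by (intro exI[of _ "\<lambda>X. x X ! k"] exI[of _ "{}"]) auto
  next
    case (NOT j)
    \<comment> \<open>Negation leaves the degree unchanged; \<open>1 \<le> l\<close> allows the
      larger exponent that its depth prescribes.\<close>
    then have "low_degree U (l ^ Suc (ds ! j)) (\<lambda>X. \<not> P j X)"
      using l wf by (intro low_degree_not low_degree_mono[OF P[rule_format]] power_increasing) auto
    then show ?thesis using NOT wf
      by (intro exI[of _ "\<lambda>X. \<not> P j X"] exI[of _ "{}"]) auto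
  next
    case (AND J)
    then have J: "J \<subseteq> {..<i}" using wf by simp
    show ?thesis
      using conjunction_approximation[OF fin index(1)[OF J] degree[OF J], where l = l]
      by (rule ex_forward, elim ex_forward) (use AND index[OF J] in \<open>auto\<close>)
  next
    case (OR J)
    then have J: "J \<subseteq> {..<i}" using wf by simp
    show ?thesis
      using disjunction_approximation[OF fin index(1)[OF J] degree[OF J], where l = l]
      by (rule ex_forward, elim ex_forward) (use OR index[OF J] in \<open>auto\<close>)
  qed
qed

text \<open>Union bound over the gates: each appended gate adds at most a fraction
  \<open>1 / 2 ^ l\<close> of all inputs to the exceptional set.\<close>

lemma circuit_approximation:
  assumes fin: "finite U" and l: "1 \<le> l"
    and inputs: "\<forall>k < N. low_degree U 1 (\<lambda>X. x X ! k)"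
    and "\<forall>i < length c. wf_gate N i (c ! i)"
  shows "\<exists>P B. B \<subseteq> Pow U \<and> card B * 2 ^ l \<le> length c * 2 ^ card U \<and>
    (\<forall>i < length c. low_degree U (l ^ (gate_depths c ! i)) (P i)) \<and>
    (\<forall>X \<in> Pow U - B. \<forall>i < length c. circuit_values c (x X) ! i = P i X)"
  using assms(4)
proof (induction c rule: rev_induct)
  case Nil
  then show ?case by (intro exI[of _ undefined] exI[of _ "{}"]) simp
next
  case (snoc g c)
  have "\<forall>i < length c. wf_gate N i (c ! i)"
    using snoc.prems by (auto simp: nth_append split: if_splits)
  from snoc.IH[OF this] obtain P B where B: "B \<subseteq> Pow U" "card B * 2 ^ l \<le> length c * 2 ^ card U"
    and P: "\<forall>i < length c. low_degree U (l ^ (gate_depths c ! i)) (P i)"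
    and good: "\<forall>X \<in> Pow U - B. \<forall>i < length c. circuit_values c (x X) ! i = P i X"
    by (elim exE conjE) (rule that)
  have "wf_gate N (length c) g" using snoc.prems by auto
  from gate_approximation[OF fin l inputs this P] obtain Q B'
    where Q: "low_degree U (l ^ gate_depth (gate_depths c) g) Q"
      and B': "B' \<subseteq> Pow U" "card B' * 2 ^ l \<le> 2 ^ card U"
      and good': "\<forall>X \<in> Pow U - B'. \<forall>vs. (\<forall>j < length c. vs ! j = P j X) \<longrightarrow>
        Q X = gate_value (x X) vs g"
    by (elim exE conjE) (rule that)
  let ?P = "P(length c := Q)"
  have "card (B \<union> B') * 2 ^ l \<le> (card B + card B') * 2 ^ l"
    by (intro mult_le_mono1 card_Un_le)
  also have "\<dots> \<le> length (c @ [g]) * 2 ^ card U"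
    using B(2) B'(2) by (simp add: add_mult_distrib)
  finally have "card (B \<union> B') * 2 ^ l \<le> length (c @ [g]) * 2 ^ card U" .
  moreover have "\<forall>i < length (c @ [g]). low_degree U (l ^ (gate_depths (c @ [g]) ! i)) (?P i)"
    using P Q by (auto simp: nth_append less_Suc_eq)
  moreover have "circuit_values (c @ [g]) (x X) ! i = ?P i X"
    if "X \<in> Pow U - (B \<union> B')" "i < length (c @ [g])" for X i
  proof -
    \<comment> \<open>Outside \<open>B\<close> the true values of the earlier gates are the
      approximated ones, hence admissible as \<open>vs\<close>.\<close>
    have "Q X = gate_value (x X) (circuit_values c (x X)) g"
      using good good' that(1) by blast
    then show ?thesis using good that by (auto simp: nth_append less_Suc_eq)
  qed
  ultimately show ?case using B(1) B'(1) by (intro exI[of _ ?P] exI[of _ "B \<union> B'"]) simp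
qed

text \<open>The circuit sees the variables only through bits of degree at most one, so a circuit for
  another problem can be used on encoded inputs without being rebuilt into one for majority.\<close>

lemma majority_circuit_size:
  assumes wf: "wf_circuit N c" and l: "1 \<le> l"
    and inputs: "\<forall>k < N. low_degree {..<2 * m + 1} 1 (\<lambda>X. x X ! k)"
    and majority: "\<And>X. X \<subseteq> {..<2 * m + 1} \<Longrightarrow> circuit_output c (x X) \<longleftrightarrow> m < card X"
    and size: "4 * circuit_size c \<le> 2 ^ l" and depth: "circuit_depth c \<le> d"
  shows "2 * m + 1 \<le> 16 * (l ^ d)\<^sup>2"
proof -
  let ?U = "{..<2 * m + 1}"
  have "c \<noteq> []" and wf': "\<forall>i < length c. wf_gate N i (c ! i)"
    using wf by (auto simp: wf_circuit_def)
  obtain P B where B: "B \<subseteq> Pow ?U" "card B * 2 ^ l \<le> length c * 2 ^ card ?U"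
    and P: "\<forall>i < length c. low_degree ?U (l ^ (gate_depths c ! i)) (P i)"
    and good: "\<forall>X \<in> Pow ?U - B. \<forall>i < length c. circuit_values c (x X) ! i = P i X"
    using circuit_approximation[where U = ?U, OF finite_lessThan l inputs wf']
    by (elim exE conjE) (rule that)
  let ?i = "length c - 1"
  have i: "?i < length c" using \<open>c \<noteq> []\<close> by simp
  have "gate_depths c \<noteq> []" using \<open>c \<noteq> []\<close> by (metis length_gate_depths length_0_conv)
  then have "circuit_depth c = gate_depths c ! ?i"
    by (simp add: circuit_depth_def flip: gate_depths_def) (simp add: last_conv_nth)
  then have "l ^ (gate_depths c ! ?i) \<le> l ^ d" using depth l by (intro power_increasing) auto
  then have deg: "low_degree ?U (l ^ d) (P ?i)" using P i low_degree_mono by blast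
  have "circuit_output c y = circuit_values c y ! ?i" for y
  proof -
    have "circuit_values c y \<noteq> []" using \<open>c \<noteq> []\<close> by (metis length_circuit_values length_0_conv)
    then show ?thesis by (simp add: circuit_output_def last_conv_nth)
  qed
  then have agree: "P ?i X \<longleftrightarrow> m < card X" if "X \<in> Pow ?U - B" for X
    using good majority[of X] that i by auto
  have "card (Pow ?U - B) \<le> card {S. S \<subseteq> ?U \<and> card S \<le> m + l ^ d}"
    using agree by (intro majority_agreement[OF _ _ deg]) auto
  also have "\<dots> \<le> 4 ^ m + l ^ d * (2 * (2 * m choose m))"
    using sum_binomial_above_half[of m "l ^ d"] by (simp only: card_subsets_card_le card_lessThan finite_lessThan)
  finally have upper: "card (Pow ?U - B) \<le> 4 ^ m + l ^ d * (2 * (2 * m choose m))" .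
  have "card B \<le> card (Pow ?U)" using B(1) by (intro card_mono) auto
  then have lower: "card (Pow ?U - B) = 2 * 4 ^ m - card B" "card B \<le> 2 * 4 ^ m"
    using B(1) by (simp_all add: card_Diff_subset finite_subset card_Pow power_mult)
  \<comment> \<open>The factor 4 in \<open>size\<close> makes \<open>B\<close> at most a quarter of
    the \<open>2 * 4 ^ m\<close> inputs.\<close>
  have "4 * card B * 2 ^ l \<le> 4 * (length c * 2 ^ card ?U)" using B(2) by simp
  also have "\<dots> \<le> 2 ^ l * (2 * 4 ^ m)"
    using mult_le_mono1[OF size, of "2 ^ card ?U"] by (simp add: circuit_size_def power_mult)
  finally have "4 * card B \<le> 2 * 4 ^ m" by simp
  \<comment> \<open>At least \<open>3 / 2 * 4 ^ m\<close> inputs are left. The lower half of the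
    monomials accounts for \<open>4 ^ m\<close> of them, so the layers above the middle must account
    for \<open>4 ^ m / 2\<close>.\<close>
  then have "4 ^ m \<le> 4 * l ^ d * (2 * m choose m)" using upper lower by simp
  \<comment> \<open>Squaring makes \<open>central_binomial_upper\<close> applicable.\<close>
  then have "(4 ^ m)\<^sup>2 \<le> (4 * l ^ d * (2 * m choose m))\<^sup>2" by (rule power_mono) simp
  moreover have "(4 ^ m)\<^sup>2 = (16 :: nat) ^ m"
    by (simp add: power2_eq_square flip: power_mult_distrib)
  ultimately have "16 ^ m \<le> 16 * (l ^ d)\<^sup>2 * (2 * m choose m)\<^sup>2"
    by (simp add: power_mult_distrib)
  from mult_le_mono1[OF this, of "2 * m + 1"]
  have "16 ^ m * (2 * m + 1) \<le> 16 * (l ^ d)\<^sup>2 * ((2 * m choose m)\<^sup>2 * (2 * m + 1))"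
    by (simp only: mult.assoc)
  also have "\<dots> \<le> 16 * (l ^ d)\<^sup>2 * 16 ^ m"
    by (intro mult_le_mono2 central_binomial_upper)
  finally have "16 ^ m * (2 * m + 1) \<le> 16 ^ m * (16 * (l ^ d)\<^sup>2)" by (simp only: mult.commute)
  then show ?thesis by (subst (asm) mult_le_cancel1) simp
qed

section \<open>Reducing majority to pattern matching\<close>

text \<open>The base \<open>x + 1\<close> is at least one, so its top power dominates the lower ones
  even at \<open>x = 0\<close>.\<close>

lemma poly_le_power_degree:
  fixes p :: "nat poly"
  shows "\<exists>K. \<forall>x. poly p x \<le> K * (x + 1) ^ degree p"
proof -
  have "poly p x \<le> (\<Sum>i\<le>degree p. coeff p i) * (x + 1) ^ degree p" for x
    unfolding poly_altdef sum_distrib_right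
    by (intro sum_mono mult_le_mono2 order.trans[OF power_mono power_increasing]) auto
  then show ?thesis by blast
qed

text \<open>It supplies a number \<open>l\<close> of parities for which \<open>2 ^ l\<close> is at
  least four times the size of a circuit whose input length is itself polynomial in
  \<open>l\<close>.\<close>

lemma poly_le_two_power: "\<exists>l \<ge> 1. poly p l \<le> (2 :: nat) ^ l"
proof -
  obtain K where K: "\<And>x. poly p x \<le> K * (x + 1) ^ degree p"
    using poly_le_power_degree by blast
  define e where "e = degree p"
  have "(\<lambda>x. real (x + 1) ^ e / 2 ^ x) \<longlonglongrightarrow> 0"
    by real_asymp
  then have "(\<lambda>x. real K * (real (x + 1) ^ e / 2 ^ x)) \<longlonglongrightarrow> 0"
    by (rule tendsto_mult_right_zero)
  then have "eventually (\<lambda>x. real K * (real (x + 1) ^ e / 2 ^ x) < 1) sequentially"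
    by (rule order_tendstoD) simp
  then obtain x where x: "x \<ge> 1" "real K * (real (x + 1) ^ e / 2 ^ x) < 1"
    using eventually_happens'[OF sequentially_bot eventually_conj[OF eventually_ge_at_top[of 1]]]
    by blast
  then have "real (K * (x + 1) ^ e) \<le> real (2 ^ x)" by (simp add: field_simps)
  then have "K * (x + 1) ^ e \<le> 2 ^ x" by (simp only: of_nat_le_iff)
  then show ?thesis using x(1) K[of x] unfolding e_def by (meson order.trans)
qed

section \<open>Patterns that count the occurrences of a letter\<close>

definition count_pattern :: "'a \<Rightarrow> nat \<Rightarrow> 'a like_pattern" where
  "count_pattern a k = concat (replicate k [Percent, Lit a]) @ [Percent]"

lemma length_count_pattern: "length (count_pattern a k) = 2 * k + 1"
  by (induction k) (auto simp: count_pattern_def)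

lemma count_pattern_Suc:
  "t \<in> like_lang (count_pattern a (Suc k)) \<longleftrightarrow>
    (\<exists>u v. t = u @ a # v \<and> v \<in> like_lang (count_pattern a k))"
  by (auto simp: count_pattern_def)

lemma like_matches_count_pattern: "like_matches t (count_pattern a k) \<longleftrightarrow> k \<le> count_list t a"
  unfolding like_matches_def
proof (induction k arbitrary: t)
  case 0
  then show ?case by (simp add: count_pattern_def)
next
  case (Suc k)
  show ?case
  proof
    assume "t \<in> like_lang (count_pattern a (Suc k))"
    then show "Suc k \<le> count_list t a" using Suc by (auto simp: count_pattern_Suc)
  next
    assume le: "Suc k \<le> count_list t a"
    then have "a \<in> set t" by (metis count_list_0_iff not_less_eq_eq zero_le)
    \<comment> \<open>Cutting at the first occurrence leaves all further ones in \<open>v\<close>,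
      to which the induction hypothesis applies.\<close>
    then obtain u v where "t = u @ a # v" "a \<notin> set u" by (meson split_list_first)
    then show "t \<in> like_lang (count_pattern a (Suc k))"
      using le Suc by (auto simp: count_pattern_Suc)
  qed
qed

section \<open>Bits of the encoded input as functions of the word\<close>

lemma nth_concat_map_block:
  assumes "\<And>s. length (f s) = b" and "k < length xs * b"
  shows "concat (map f xs) ! k = f (xs ! (k div b)) ! (k mod b)"
  using assms(2)
proof (induction xs arbitrary: k)
  case Nil
  then show ?case by simp
next
  case (Cons y xs)
  then have "b > 0" by (metis mult_0_right not_less_zero gr0I)
  show ?case
  proof (cases "k < b")
    case True
    then show ?thesis by (simp add: nth_append assms(1))
  next
    case False
    then have "k - b < length xs * b" using Cons.prems by auto
    moreover have "k div b = Suc ((k - b) div b)" "k mod b = (k - b) mod b"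
      using False \<open>b > 0\<close> by (simp_all add: le_div_geq le_mod_geq)
    ultimately show ?thesis using Cons.IH[of "k - b"] False by (simp add: nth_append assms(1))
  qed
qed

definition word_of_set :: "'a \<Rightarrow> 'a \<Rightarrow> nat \<Rightarrow> nat set \<Rightarrow> 'a list" where
  "word_of_set a b n X = map (\<lambda>i. if i \<in> X then b else a) [0..<n]"

lemma count_list_word_of_set:
  assumes "a \<noteq> b" and "X \<subseteq> {..<n}"
  shows "count_list (word_of_set a b n X) b = card X"
proof -
  have "count_list (word_of_set a b n X) b = card (X \<inter> {..<n})"
  proof (induction n)
    case (Suc n)
    then show ?case using assms(1) by (auto simp: word_of_set_def lessThan_Suc)
  qed (simp add: word_of_set_def)
  then show ?thesis using assms(2) by (simp add: Int_absorb2)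
qed

lemma length_encode_input:
  assumes "\<And>s. length (code s) = b"
  shows "length (encode_input code p t) = b * (length p + 1 + length t)"
  using assms by (simp add: encode_input_def length_concat comp_def sum_list_triv algebra_simps)

text \<open>As all blocks have equal length, a bit position belongs to one fixed token. That token
  is either constant or a single letter of the word, so the bit depends on at most one
  variable.\<close>

lemma low_degree_encoding:
  assumes b: "\<And>s. length (code s) = b" and k: "k < b * (length p + 1 + n)"
  shows "low_degree {..<n} 1 (\<lambda>X. encode_input code p (word_of_set a a' n X) ! k)"
proof -
  let ?q = "map Sym p @ [Separator]"
  let ?w = "\<lambda>X. ?q @ map (\<lambda>a. Sym (Lit a)) (word_of_set a a' n X)"
  have len: "length (?w X) = length p + 1 + n" for X by (simp add: word_of_set_def)
  have nth: "encode_input code p (word_of_set a a' n X) ! k = code (?w X ! (k div b)) ! (k mod b)" for X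
    using nth_concat_map_block[of code b k "?w X", OF b] k len[of X]
    by (simp add: encode_input_def mult.commute)
  have lt: "k div b < length p + 1 + n" using k by (simp add: less_mult_imp_div_less mult.commute)
  show ?thesis
  proof (cases "k div b < length ?q")
    case True
    then have "?w X ! (k div b) = ?q ! (k div b)" for X by (simp only: nth_append if_True)
    then show ?thesis unfolding nth by (simp only: low_degree_const)
  next
    case False
    let ?i = "k div b - length ?q"
    have i: "?i < n" using lt False by auto
    have "?w X ! (k div b) = Sym (Lit (if ?i \<in> X then a' else a))" for X
      using False i by (simp only: nth_append if_False) (simp add: word_of_set_def)
    then have bit: "encode_input code p (word_of_set a a' n X) ! k \<longleftrightarrow>
        code (Sym (Lit (if ?i \<in> X then a' else a))) ! (k mod b)" for X
      by (simp only: nth)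
    \<comment> \<open>Such a choice between two truth values is constant, the variable or its
      negation.\<close>
    have "low_degree {..<n} 1 (\<lambda>X. if ?i \<in> X then c1 else c0)" for c1 c0
    proof -
      have "low_degree {..<n} 1 (\<lambda>X. {?i} \<subseteq> X)"
        using i by (intro low_degree_monomial) auto
      from low_degree_not[OF this] this show ?thesis
        by (cases c1; cases c0) (simp_all add: low_degree_const)
    qed
    then show ?thesis
      unfolding bit if_distrib[of "\<lambda>c. code (Sym (Lit c)) ! (k mod b)"] .
  qed
qed

theorem theorem2:
  fixes sym0 sym1 :: "'a :: finite"
    and code :: "'a token \<Rightarrow> bool list"
  assumes "sym0 \<noteq> sym1"
    and "block_code code"
  shows "like_problem code \<notin> AC0"
proof
  assume "like_problem code \<in> AC0"
  then obtain C q d where wf: "\<And>n. wf_circuit n (C n)"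
    and size: "\<And>n. circuit_size (C n) \<le> poly q n" and depth: "\<And>n. circuit_depth (C n) \<le> d"
    and correct: "\<And>x. circuit_output (C (length x)) x \<longleftrightarrow> x \<in> like_problem code"
    unfolding AC0_def by blast
  obtain b where b: "\<And>s. length (code s) = b"
    using assms(2) by (auto simp: block_code_def)
  \<comment> \<open>\<open>m = 8 l\<^sup>2\<^sup>d\<close> violates the bound on \<open>m\<close>, and \<open>r l\<close> is four times the size bound at the length of
    the encoded input, a polynomial in \<open>l\<close>.\<close>
  define r :: "nat poly" where
    "r = smult 4 (pcompose q (smult b (smult 32 (monom 1 (2 * d)) + [:5:])))"
  obtain l where l: "l \<ge> 1" and r: "poly r l \<le> 2 ^ l" using poly_le_two_power by blast
  define m where "m = 8 * (l ^ d)\<^sup>2"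
  define p where "p = count_pattern sym1 (m + 1)"
  define N where "N = b * (length p + 1 + (2 * m + 1))"
  let ?x = "\<lambda>X. encode_input code p (word_of_set sym0 sym1 (2 * m + 1) X)"
  \<comment> \<open>The pattern has \<open>2 * m + 3\<close> symbols, the separator counts one, and
    the word has \<open>2 * m + 1\<close> letters. With \<open>m\<close> inserted, this is the
    argument \<open>32 * l ^ (2 * d) + 5\<close> in \<open>r\<close>.\<close>
  have "length p + 1 + (2 * m + 1) = 4 * m + 5" by (simp add: p_def length_count_pattern)
  then have N: "N = b * (4 * m + 5)" by (simp only: N_def)
  have len: "length (?x X) = N" for X
    by (simp add: length_encode_input[OF b] N_def word_of_set_def)
  have "2 * m + 1 \<le> 16 * (l ^ d)\<^sup>2"
  proof (rule majority_circuit_size[OF wf[of N] l])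
    show "\<forall>k < N. low_degree {..<2 * m + 1} 1 (\<lambda>X. ?x X ! k)"
      using low_degree_encoding[of code b, OF b] by (simp only: N_def) blast
    show "circuit_output (C N) (?x X) \<longleftrightarrow> m < card X" if "X \<subseteq> {..<2 * m + 1}" for X
    proof -
      have "circuit_output (C N) (?x X) \<longleftrightarrow> ?x X \<in> like_problem code"
        using correct[of "?x X"] by (simp only: len)
      \<comment> \<open>Membership only provides some matching pair with this encoding; injectivity
        identifies it with the present pair.\<close>
      also have "\<dots> \<longleftrightarrow> like_matches (word_of_set sym0 sym1 (2 * m + 1) X) p"
        using encode_input_inject[OF assms(2)] by (auto simp: like_problem_def)
      also have "\<dots> \<longleftrightarrow> m < card X"
        unfolding p_def like_matches_count_pattern count_list_word_of_set[OF assms(1) that] by auto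
      finally show ?thesis .
    qed
    have "poly r l = 4 * poly q N"
      by (simp add: r_def poly_pcompose poly_monom N m_def power_even_eq)
    then show "4 * circuit_size (C N) \<le> 2 ^ l" using size[of N] r by linarith
  qed (rule depth)
  then show False unfolding m_def by linarith
qed

end
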